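(* Let $\mathbb{K}$ be a field of characteristic different from $2$, let $n=2k$ for some positive integer $k$, let $V$ be a $\mathbb{K}$-vector space of dimension $n$, and let $\{e_1,\dots,e_n\}$ be a basis of the dual space $V^*$. Let $$I_{2k}=\{(i_1,j_1,\dots,i_k,j_k)\in\mathbb{Z}^{2k} \mid i_1,j_1,\dots,i_k,j_k\in\{1,\dots,2k\}\text{ are pairwise different, and } i_p<j_p \text{ for each } 1\le p\le k\},$$ and for pairwise different $a_1,\dots,a_{2k}\in\{1,\dots,2k\}$ let $S_{a_1,a_2,\dots,a_{2k}}\in\{1,-1\}$ denote the sign of the permutation $p\mapsto a_p$ of $\{1,\dots,2k\}$. Then, in $(V^* )^{\otimes n}$, $$\begin{aligned} \det\nolimits_n={}&\frac12\sum_{(i_1,j_1,\dots,i_k,j_k)\in I_{2k}}S_{i_1,j_1,\dots,i_k,j_k}\,(e_{i_1}-e_{j_1})\otimes(e_{i_2}-e_{j_2})\otimes\cdots\otimes(e_{i_k}-e_{j_k})\otimes(e_{i_k}+e_{j_k})\otimes\cdots\otimes(e_{i_2}+e_{j_2})\otimes(e_{i_1}+e_{j_1})\\ &+\frac12\sum_{(i_1,j_1,\dots,i_k,j_k)\in I_{2k}}(-1)^k S_{i_1,j_1,\dots,i_k,j_k}\,(e_{i_1}+e_{j_1})\otimes(e_{i_2}+e_{j_2})\otimes\cdots\otimes(e_{i_k}+e_{j_k})\otimes(e_{i_k}-e_{j_k})\otimes\cdots\otimes(e_{i_2}-e_{j_2})\otimes(e_{i_1}-e_{j_1}). \end{ali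gned}$$
   Context: The $n\times n$ determinant tensor $\det_n\in(V^* )^{\otimes n}$, with respect to the basis $\{e_1,\dots,e_n\}$ of $V^*$, is $$\det\nolimits_n=\sum_{\sigma\in S_n}\operatorname{sgn}(\sigma)\,e_{\sigma(1)}\otimes e_{\sigma(2)}\otimes\cdots\otimes e_{\sigma(n)},$$ where $S_n$ is the symmetric group on $n$ letters and $\operatorname{sgn}(\sigma)$ is the sign of $\sigma$. In each summand of the claimed formula, the first $k$ tensor factors are indexed by the pairs $(i_p,j_p)$ in the order $p=1,2,\dots,k$, and the last $k$ tensor factors are indexed by the pairs in the reverse order $p=k,k-1,\dots,1$. *)

theory Defs
  imports
    Complex_Main
    "HOL-Algebra.Module"
    "HOL-Library.Function_Algebras"
    "HOL-Combinatorics.Permutations"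
    "HOL-Computational_Algebra.Primes"
begin

(* The field is a type 'k::field and V is a vector space on a type 'v with scalar multiplication s
   (locale vector_space).  Functions into 'k form a vector space under the pointwise operations;
   it is used both for the dual space and for free vector spaces.  The tensor power is a quotient
   depending on n, so it is not a type but an HOL-Algebra module record. *)

definition fun_scale :: "'k::field \<Rightarrow> ('x \<Rightarrow> 'k) \<Rightarrow> 'x \<Rightarrow> 'k" where
  "fun_scale c f = (\<lambda>x. c * f x)"

interpretation fun_vs: vector_space fun_scale
  by unfold_locales (auto simp: fun_scale_def fun_eq_iff algebra_simps)

definition dual_space :: "('k::field \<Rightarrow> 'v::ab_group_add \<Rightarrow> 'v) \<Rightarrow> ('v \<Rightarrow> 'k) set" where
  "dual_space s = {f. Vector_Spaces.linear s (*) f}"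

definition is_basis :: "nat \<Rightarrow> ('x \<Rightarrow> 'k::field) set \<Rightarrow> (nat \<Rightarrow> 'x \<Rightarrow> 'k) \<Rightarrow> bool" where
  "is_basis n W e \<longleftrightarrow>
     inj_on e {1..n} \<and> fun_vs.independent (e ` {1..n}) \<and> fun_vs.span (e ` {1..n}) = W"


text \<open>
  The \<open>n\<close>-th tensor power of a subspace \<open>W\<close> of a space of functions: the free vector
  space on \<open>W\<^sup>n\<close> (lists of length \<open>n\<close> with entries in \<open>W\<close>), modulo the subspace generated
  by the multilinearity relations.  Its elements are cosets.
\<close>

definition tuples :: "nat \<Rightarrow> 'w set \<Rightarrow> 'w list set" where
  "tuples n W = {ws. length ws = n \<and> set ws \<subseteq> W}"

definition delta :: "'a \<Rightarrow> 'a \<Rightarrow> 'k::field" where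
  "delta x = (\<lambda>y. if y = x then 1 else 0)"

definition free_space :: "'a set \<Rightarrow> ('a \<Rightarrow> 'k::field) set" where
  "free_space X = {f. finite {x. f x \<noteq> 0} \<and> {x. f x \<noteq> 0} \<subseteq> X}"

definition tensor_relations :: "nat \<Rightarrow> ('x \<Rightarrow> 'k::field) set \<Rightarrow> (('x \<Rightarrow> 'k) list \<Rightarrow> 'k) set" where
  "tensor_relations n W =
     {delta (ws[i := u + v]) - delta (ws[i := u]) - delta (ws[i := v]) | ws i u v.
        ws \<in> tuples n W \<and> i < n \<and> u \<in> W \<and> v \<in> W} \<union>
     {delta (ws[i := fun_scale c u]) - fun_scale c (delta (ws[i := u])) | ws i c u.
        ws \<in> tuples n W \<and> i < n \<and> u \<in> W}"

definition tensor_class ::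
  "nat \<Rightarrow> ('x \<Rightarrow> 'k::field) set \<Rightarrow> (('x \<Rightarrow> 'k) list \<Rightarrow> 'k) \<Rightarrow> (('x \<Rightarrow> 'k) list \<Rightarrow> 'k) set" where
  "tensor_class n W f = {g. g - f \<in> fun_vs.span (tensor_relations n W)}"

(* The ring multiplication and unit are fields of the record type without meaning for a module. *)
definition tensor_power ::
  "nat \<Rightarrow> ('x \<Rightarrow> 'k::field) set \<Rightarrow> ('k, (('x \<Rightarrow> 'k) list \<Rightarrow> 'k) set) module" where
  "tensor_power n W =
     \<lparr>carrier = tensor_class n W ` free_space (tuples n W),
      monoid.mult = undefined,
      one = undefined,
      zero = tensor_class n W 0,
      add = (\<lambda>A B. \<Union>a\<in>A. \<Union>b\<in>B. tensor_class n W (a + b)),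
      smult = (\<lambda>c A. \<Union>a\<in>A. tensor_class n W (fun_scale c a))\<rparr>"

text \<open>The elementary tensor \<open>w\<^sub>1 \<otimes> \<dots> \<otimes> w\<^sub>n\<close> of \<open>ws = [w\<^sub>1, \<dots>, w\<^sub>n]\<close>.\<close>

definition pure_tensor ::
  "nat \<Rightarrow> ('x \<Rightarrow> 'k::field) set \<Rightarrow> ('x \<Rightarrow> 'k) list \<Rightarrow> (('x \<Rightarrow> 'k) list \<Rightarrow> 'k) set" where
  "pure_tensor n W ws = tensor_class n W (delta ws)"

definition det_tensor ::
  "nat \<Rightarrow> ('x \<Rightarrow> 'k::field) set \<Rightarrow> (nat \<Rightarrow> 'x \<Rightarrow> 'k) \<Rightarrow> (('x \<Rightarrow> 'k) list \<Rightarrow> 'k) set" where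
  "det_tensor n W e =
     (\<Oplus>\<^bsub>tensor_power n W\<^esub>\<sigma>\<in>{\<sigma>. \<sigma> permutes {1..n}}.
        of_int (sign \<sigma>) \<odot>\<^bsub>tensor_power n W\<^esub> pure_tensor n W (map (\<lambda>p. e (\<sigma> p)) [1..<n+1]))"


text \<open>
  A tuple \<open>(i\<^sub>1, j\<^sub>1, \<dots>, i\<^sub>k, j\<^sub>k)\<close> is a list of length \<open>2k\<close>; list positions count from 0,
  whereas \<open>p\<close> ranges over \<open>1, \<dots>, k\<close>.
\<close>

definition idx_i :: "nat list \<Rightarrow> nat \<Rightarrow> nat" where
  "idx_i a p = a ! (2 * p - 2)"

definition idx_j :: "nat list \<Rightarrow> nat \<Rightarrow> nat" where
  "idx_j a p = a ! (2 * p - 1)"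

definition index_set :: "nat \<Rightarrow> nat list set" where
  "index_set k =
     {a. length a = 2 * k \<and> set a \<subseteq> {1..2 * k} \<and> distinct a \<and> (\<forall>p\<in>{1..k}. idx_i a p < idx_j a p)}"

definition tuple_sign :: "nat list \<Rightarrow> int" where
  "tuple_sign a = sign (\<lambda>p. if p \<in> {1..length a} then a ! (p - 1) else p)"


text \<open>The quotient operations are the ones induced from the free vector space.\<close>

lemma tensor_class_eq_iff:
  "tensor_class n W f = tensor_class n W g \<longleftrightarrow> f - g \<in> fun_vs.span (tensor_relations n W)"
proof
  assume "tensor_class n W f = tensor_class n W g"
  moreover have "f \<in> tensor_class n W f"
    by (simp add: tensor_class_def fun_vs.span_zero)
  ultimately show "f - g \<in> fun_vs.span (tensor_relations n W)"
    by (simp add: tensor_class_def)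
next
  assume fg: "f - g \<in> fun_vs.span (tensor_relations n W)"
  have "h - f \<in> fun_vs.span (tensor_relations n W) \<longleftrightarrow>
        h - g \<in> fun_vs.span (tensor_relations n W)" for h
  proof
    assume "h - f \<in> fun_vs.span (tensor_relations n W)"
    from fun_vs.span_add[OF this fg] show "h - g \<in> fun_vs.span (tensor_relations n W)"
      by (simp only: diff_add_cancel add_diff_eq)
  next
    assume "h - g \<in> fun_vs.span (tensor_relations n W)"
    from fun_vs.span_diff[OF this fg] show "h - f \<in> fun_vs.span (tensor_relations n W)"
      by (simp only: diff_diff_eq2 diff_add_cancel)
  qed
  then show "tensor_class n W f = tensor_class n W g"
    by (simp add: tensor_class_def)
qed

lemma tensor_class_self: "f \<in> tensor_class n W f"
  by (simp add: tensor_class_def fun_vs.span_zero)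

lemma tensor_power_add:
  "tensor_class n W f \<oplus>\<^bsub>tensor_power n W\<^esub> tensor_class n W g = tensor_class n W (f + g)"
proof -
  have "tensor_class n W (a + b) = tensor_class n W (f + g)"
    if "a \<in> tensor_class n W f" "b \<in> tensor_class n W g" for a b
    using fun_vs.span_add[of "a - f" "tensor_relations n W" "b - g"] that
    unfolding tensor_class_eq_iff add_diff_add by (simp only: tensor_class_def mem_Collect_eq)
  then have "(\<Union>a\<in>tensor_class n W f. \<Union>b\<in>tensor_class n W g. tensor_class n W (a + b)) =
      tensor_class n W (f + g)"
    using tensor_class_self[of f n W] tensor_class_self[of g n W] by blast
  then show ?thesis
    by (simp only: tensor_power_def ring.simps)
qed

lemma tensor_power_smult:
  "c \<odot>\<^bsub>tensor_power n W\<^esub> tensor_class n W f = tensor_class n W (fun_scale c f)"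
proof -
  have "tensor_class n W (fun_scale c a) = tensor_class n W (fun_scale c f)"
    if "a \<in> tensor_class n W f" for a
    using fun_vs.span_scale[of "a - f" "tensor_relations n W" c] that
    unfolding tensor_class_eq_iff
    by (simp only: tensor_class_def mem_Collect_eq fun_vs.scale_right_diff_distrib)
  then have "(\<Union>a\<in>tensor_class n W f. tensor_class n W (fun_scale c a)) =
      tensor_class n W (fun_scale c f)"
    using tensor_class_self[of f n W] by blast
  then show ?thesis
    by (simp only: tensor_power_def module.simps)
qed

lemma subspace_free_space: "fun_vs.subspace (free_space X :: ('a \<Rightarrow> 'k::field) set)"
proof (rule fun_vs.subspaceI)
  show "(0 :: 'a \<Rightarrow> 'k) \<in> free_space X"
    by (simp add: free_space_def)
next
  fix f g :: "'a \<Rightarrow> 'k" assume fg: "f \<in> free_space X" "g \<in> free_space X"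
  have sub: "{x. (f + g) x \<noteq> 0} \<subseteq> {x. f x \<noteq> 0} \<union> {x. g x \<noteq> 0}"
    by auto
  have "finite ({x. f x \<noteq> 0} \<union> {x. g x \<noteq> 0})" "{x. f x \<noteq> 0} \<union> {x. g x \<noteq> 0} \<subseteq> X"
    using fg by (simp_all add: free_space_def)
  from finite_subset[OF sub this(1)] subset_trans[OF sub this(2)]
  show "f + g \<in> free_space X"
    unfolding free_space_def mem_Collect_eq by (rule conjI)
next
  fix c :: 'k and f :: "'a \<Rightarrow> 'k" assume f: "f \<in> free_space X"
  have sub: "{x. fun_scale c f x \<noteq> 0} \<subseteq> {x. f x \<noteq> 0}"
    by (auto simp: fun_scale_def)
  have "finite {x. f x \<noteq> 0}" "{x. f x \<noteq> 0} \<subseteq> X"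
    using f by (simp_all add: free_space_def)
  from finite_subset[OF sub this(1)] subset_trans[OF sub this(2)]
  show "fun_scale c f \<in> free_space X"
    unfolding free_space_def mem_Collect_eq by (rule conjI)
qed

lemma abelian_group_tensor_power: "abelian_group (tensor_power n W)"
proof (rule abelian_groupI)
  let ?T = "tensor_power n W" and ?F = "free_space (tuples n W)"
  have carr: "carrier ?T = tensor_class n W ` ?F" and zero: "\<zero>\<^bsub>?T\<^esub> = tensor_class n W 0"
    by (simp_all add: tensor_power_def)
  show "\<zero>\<^bsub>?T\<^esub> \<in> carrier ?T"
    using fun_vs.subspace_0[OF subspace_free_space] by (auto simp: carr zero)
  fix x assume "x \<in> carrier ?T"
  then obtain f where f: "f \<in> ?F" "x = tensor_class n W f"
    by (auto simp: carr)
  show "\<zero>\<^bsub>?T\<^esub> \<oplus>\<^bsub>?T\<^esub> x = x"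
    by (simp add: zero f tensor_power_add)
  have "tensor_class n W (- f) \<oplus>\<^bsub>?T\<^esub> x = \<zero>\<^bsub>?T\<^esub>"
    by (simp add: zero f tensor_power_add)
  moreover have "tensor_class n W (- f) \<in> carrier ?T"
    using fun_vs.subspace_neg[OF subspace_free_space f(1)] by (auto simp: carr)
  ultimately show "\<exists>y\<in>carrier ?T. y \<oplus>\<^bsub>?T\<^esub> x = \<zero>\<^bsub>?T\<^esub>"
    by blast
  fix y assume "y \<in> carrier ?T"
  then obtain g where g: "g \<in> ?F" "y = tensor_class n W g"
    by (auto simp: carr)
  show "x \<oplus>\<^bsub>?T\<^esub> y \<in> carrier ?T"
    using fun_vs.subspace_add[OF subspace_free_space f(1) g(1)]
    by (auto simp: carr f g tensor_power_add)
  show "x \<oplus>\<^bsub>?T\<^esub> y = y \<oplus>\<^bsub>?T\<^esub> x"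
    by (simp add: f g tensor_power_add add.commute)
  fix z assume "z \<in> carrier ?T"
  then obtain h where h: "h \<in> ?F" "z = tensor_class n W h"
    by (auto simp: carr)
  show "x \<oplus>\<^bsub>?T\<^esub> y \<oplus>\<^bsub>?T\<^esub> z = x \<oplus>\<^bsub>?T\<^esub> (y \<oplus>\<^bsub>?T\<^esub> z)"
    by (simp add: f g h tensor_power_add add.assoc)
qed

lemma tensor_power_smult_closed:
  assumes "x \<in> carrier (tensor_power n W)"
  shows "c \<odot>\<^bsub>tensor_power n W\<^esub> x \<in> carrier (tensor_power n W)"
proof -
  from assms obtain f where f: "f \<in> free_space (tuples n W)" "x = tensor_class n W f"
    by (auto simp: tensor_power_def)
  have "tensor_class n W (fun_scale c f) \<in> carrier (tensor_power n W)"
    using fun_vs.subspace_scale[OF subspace_free_space f(1)] by (auto simp: tensor_power_def)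
  then show ?thesis
    by (simp add: f tensor_power_smult)
qed

lemma pure_tensor_closed:
  assumes "ws \<in> tuples n W"
  shows "pure_tensor n W ws \<in> carrier (tensor_power n W)"
  using assms by (auto simp: pure_tensor_def tensor_power_def free_space_def delta_def)

end

theory Submission
  imports Defs
begin

text \<open>
  Write \<open>q' = n + 1 - q\<close>. Linear functionals on the free vector space that kill the multilinearity
  relations separate tensors, so it suffices to prove the identity in the field for a map \<open>L\<close>
  that is additive in each of the \<open>n\<close> positions. Expanding the factors \<open>e\<^sub>i - e\<^sub>j\<close> turns the sum
  over ordered pairs \<open>i < j\<close> into a signed sum over all permutations, since choosing \<open>-e\<^sub>j\<close>
  amounts to swapping \<open>i\<close> and \<open>j\<close>. Expanding the factors \<open>e\<^sub>i + e\<^sub>j\<close> as well gives sums \<open>Q R\<close>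
  over subsets \<open>R\<close> of one half of the positions: in \<open>Q R\<close> the entry of a permutation at \<open>q \<in> R\<close>
  is replaced by its entry at \<open>q'\<close>. Here \<open>Q {}\<close> is the determinant. If \<open>R\<close> contains distinct \<open>p\<close>
  and \<open>q\<close>, then the entries at \<open>p\<close> and \<open>q\<close> do not occur, so exchanging them changes only the
  sign and \<open>Q R = 0\<close>. The remaining terms cancel between the two halves of the formula because
  \<open>Q {p'} = - Q {p}\<close>.
\<close>

section \<open>Multiadditive maps\<close>

text \<open>Tuples are functions on positions, so that changing one factor is a function update;
  \<open>cong\<close> disregards values outside \<open>{1..n}\<close>. Inside the factors only the
  coefficients 1 and -1 occur, so additivity suffices.\<close>

locale multiadditive =
  fixes n :: nat and W :: "'w::ab_group_add set" and L :: "(nat \<Rightarrow> 'w) \<Rightarrow> 'k::field"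
  assumes add_closed: "u \<in> W \<Longrightarrow> v \<in> W \<Longrightarrow> u + v \<in> W"
    and uminus_closed: "u \<in> W \<Longrightarrow> - u \<in> W"
    and cong: "(\<And>q. q \<in> {1..n} \<Longrightarrow> g q = h q) \<Longrightarrow> L g = L h"
    and add: "g \<in> {1..n} \<rightarrow> W \<Longrightarrow> p \<in> {1..n} \<Longrightarrow> u \<in> W \<Longrightarrow> v \<in> W \<Longrightarrow>
      L (g(p := u + v)) = L (g(p := u)) + L (g(p := v))"
begin

lemma uminus:
  assumes g: "g \<in> {1..n} \<rightarrow> W" and p: "p \<in> {1..n}" and u: "u \<in> W"
  shows "L (g(p := - u)) = - L (g(p := u))"
proof -
  have zero: "0 \<in> W"
    using add_closed[OF u uminus_closed[OF u]] by simp
  have "L (g(p := 0)) = 0"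
    using add[OF g p zero zero] unfolding add_0 by (metis add_cancel_left_left)
  with add[OF g p u uminus_closed[OF u]] show ?thesis
    by (simp add: eq_neg_iff_add_eq_0 add.commute)
qed

text \<open>\<open>R\<close> collects the positions in \<open>P\<close> that choose
  \<open>v\<close>. In the induction \<open>u\<close> stays arbitrary because choosing
  \<open>v\<close> at a new position \<open>p\<close> is absorbed by the update
  \<open>u(p := v p)\<close>.\<close>

lemma sum_expansion:
  assumes "P \<subseteq> {1..n}" and u: "u \<in> {1..n} \<rightarrow> W" and v: "v \<in> {1..n} \<rightarrow> W"
  shows "L (\<lambda>q. if q \<in> P then u q + v q else u q) =
    (\<Sum>R\<in>Pow P. L (\<lambda>q. if q \<in> R then v q else u q))"
proof -
  from assms(1) have "finite P"
    by (rule finite_subset) simp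
  then show ?thesis
    using assms(1) u
  proof (induction P arbitrary: u rule: finite_induct)
    case empty
    then show ?case by simp
  next
    case (insert p P)
    let ?G = "\<lambda>u q. if q \<in> P then u q + v q else u q"
    let ?u = "u(p := v p)"
    have p: "p \<in> {1..n}" and PS: "P \<subseteq> {1..n}"
      using insert.prems(1) by auto
    have mem: "u q \<in> W" "v q \<in> W" if "q \<in> {1..n}" for q
      using funcset_mem[OF insert.prems(2) that] funcset_mem[OF v that] .
    have G: "?G u \<in> {1..n} \<rightarrow> W" and u': "?u \<in> {1..n} \<rightarrow> W"
      by (auto intro!: add_closed mem p simp del: atLeastAtMost_iff)
    have inj: "inj_on (insert p) (Pow P)"
      using insert.hyps(2) by (force simp: inj_on_def)
    have "L (\<lambda>q. if q \<in> insert p P then u q + v q else u q) = L ((?G u)(p := u p + v p))"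
      by (rule cong) auto
    also have "\<dots> = L ((?G u)(p := u p)) + L ((?G u)(p := v p))"
      using add[OF G p mem[OF p]] .
    also have "(?G u)(p := u p) = ?G u"
      using insert.hyps by auto
    also have "(?G u)(p := v p) = ?G ?u"
      using insert.hyps by auto
    also have "L (?G u) + L (?G ?u) = (\<Sum>R\<in>Pow P. L (\<lambda>q. if q \<in> R then v q else u q)) +
        (\<Sum>R\<in>Pow P. L (\<lambda>q. if q \<in> R then v q else ?u q))"
      by (simp only: insert.IH[OF PS insert.prems(2)] insert.IH[OF PS u'])
    \<comment> \<open>The choices of \<open>v\<close> at \<open>p\<close> are the subsets that
      contain \<open>p\<close>, obtained from those of \<open>P\<close> by
      \<open>insert p\<close>.\<close>
    also have "(\<Sum>R\<in>Pow P. L (\<lambda>q. if q \<in> R then v q else ?u q)) =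
        (\<Sum>R\<in>insert p ` Pow P. L (\<lambda>q. if q \<in> R then v q else u q))"
      unfolding sum.reindex[OF inj] by (intro sum.cong refl) (auto intro!: cong)
    also have "(\<Sum>R\<in>Pow P. L (\<lambda>q. if q \<in> R then v q else u q)) + \<dots> =
        (\<Sum>R\<in>Pow (insert p P). L (\<lambda>q. if q \<in> R then v q else u q))"
      unfolding Pow_insert using insert.hyps
      by (intro sum.union_disjoint[symmetric]) auto
    finally show ?case .
  qed
qed

text \<open>The minus signs come out one position at a time; the freed \<open>v p\<close> is again
  absorbed into \<open>u\<close>.\<close>

lemma uminus_expansion:
  assumes "R \<subseteq> {1..n}" and u: "u \<in> {1..n} \<rightarrow> W" and v: "v \<in> {1..n} \<rightarrow> W"
  shows "L (\<lambda>q. if q \<in> R then - v q else u q) =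
    (- 1) ^ card R * L (\<lambda>q. if q \<in> R then v q else u q)"
proof -
  from assms(1) have "finite R"
    by (rule finite_subset) simp
  then show ?thesis
    using assms(1) u
  proof (induction R arbitrary: u rule: finite_induct)
    case empty
    then show ?case by simp
  next
    case (insert p R)
    let ?g = "\<lambda>q. if q \<in> R then - v q else u q"
    have p: "p \<in> {1..n}" and RS: "R \<subseteq> {1..n}"
      using insert.prems(1) by auto
    have mem: "u q \<in> W" "v q \<in> W" if "q \<in> {1..n}" for q
      using funcset_mem[OF insert.prems(2) that] funcset_mem[OF v that] .
    note vp = mem(2)[OF p]
    have g: "?g \<in> {1..n} \<rightarrow> W" and u': "u(p := v p) \<in> {1..n} \<rightarrow> W"
      by (auto intro!: uminus_closed mem p simp del: atLeastAtMost_iff)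
    have "L (\<lambda>q. if q \<in> insert p R then - v q else u q) = L (?g(p := - v p))"
      by (rule cong) auto
    also have "\<dots> = - L (?g(p := v p))"
      by (rule uminus[OF g p vp])
    also have "?g(p := v p) = (\<lambda>q. if q \<in> R then - v q else (u(p := v p)) q)"
      using insert.hyps by auto
    also have "- L \<dots> = - ((- 1) ^ card R * L (\<lambda>q. if q \<in> R then v q else (u(p := v p)) q))"
      by (simp only: insert.IH[OF RS u'])
    also have "L (\<lambda>q. if q \<in> R then v q else (u(p := v p)) q) =
        L (\<lambda>q. if q \<in> insert p R then v q else u q)"
      by (rule cong) auto
    finally show ?case
      using insert.hyps by simp
  qed
qed

end

section \<open>Permutations and mirrored positions\<close>

text \<open>A choice of one position from each pair \<open>q, q'\<close>; it exists only for even \<open>n\<close>.\<close>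

definition half :: "nat \<Rightarrow> nat set \<Rightarrow> bool" where
  "half n H \<longleftrightarrow> H \<subseteq> {1..n} \<and> (\<forall>q\<in>{1..n}. q \<in> H \<longleftrightarrow> n + 1 - q \<notin> H)"

lemma mirror_mem: "q \<in> {1..n} \<Longrightarrow> n + 1 - q \<in> {1..n}" for n q :: nat
  by auto

lemma mirror_mirror: "q \<in> {1..n} \<Longrightarrow> n + 1 - (n + 1 - q) = q" for n q :: nat
  by auto

lemma half_subset: "half n H \<Longrightarrow> H \<subseteq> {1..n}"
  unfolding half_def by (rule conjunct1)

lemma half_iff: "half n H \<Longrightarrow> q \<in> {1..n} \<Longrightarrow> n + 1 - q \<in> H \<longleftrightarrow> q \<notin> H"
  unfolding half_def by blast

lemma half_Compl:
  assumes "half n H" shows "half n ({1..n} - H)"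
  unfolding half_def using half_iff[OF assms] mirror_mem by blast

text \<open>A self-mirrored position would belong to \<open>H\<close> exactly if it did not.\<close>

lemma half_fixpoint_free:
  assumes "half n H" "q \<in> {1..n}" shows "n + 1 - q \<noteq> q"
proof
  assume eq: "n + 1 - q = q"
  show False
    using half_iff[OF assms] unfolding eq by simp
qed

text \<open>This encodes the choice of the terms \<open>-e_j\<close>:
  \<open>\<sigma> \<circ> flip n X\<close> exchanges the entries of \<open>\<sigma>\<close> in the
  mirrored pairs that meet \<open>X\<close>.\<close>

definition flip :: "nat \<Rightarrow> nat set \<Rightarrow> nat \<Rightarrow> nat" where
  "flip n X q = (if q \<in> X \<or> n + 1 - q \<in> X then n + 1 - q else q)"

lemma flip_not_in:
  assumes "X \<subseteq> {1..n}" "q \<notin> {1..n}" shows "flip n X q = q"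
proof -
  \<comment> \<open>Subtraction is truncated: the mirror of \<open>q > n\<close> is 0, and the
    mirror of 0 is \<open>n + 1\<close>; neither is a position.\<close>
  have "q = 0 \<or> n + 1 - q = 0"
    using assms(2) by auto
  then have "n + 1 - q \<notin> {1..n}"
    by auto
  then have "q \<notin> X" "n + 1 - q \<notin> X"
    using assms by blast+
  then show ?thesis
    by (simp add: flip_def)
qed

text \<open>Both \<open>p\<close> and its mirror avoid \<open>X\<close>, the latter because it lies
  outside \<open>H\<close>, so \<open>flip n X\<close> leaves this pair alone.\<close>

lemma flip_insert:
  assumes H: "half n H" and X: "insert p X \<subseteq> H" and p: "p \<notin> X"
  shows "flip n (insert p X) = transpose p (n + 1 - p) \<circ> flip n X"
proof
  fix q
  have sub: "X \<subseteq> {1..n}" "p \<in> {1..n}"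
    using X half_subset[OF H] by blast+
  have mirror: "n + 1 - p \<notin> X"
    using X half_iff[OF H sub(2)] by blast
  show "flip n (insert p X) q = (transpose p (n + 1 - p) \<circ> flip n X) q"
  proof (cases "q \<in> {1..n}")
    case True
    obtain p' q' where eq: "n + 1 - p = p'" "n + 1 - q = q'"
      by blast
    have "q' = p \<longleftrightarrow> q = p'" "q' = p' \<longleftrightarrow> q = p"
      using True sub(2) unfolding eq[symmetric] by auto
    with mirror p show ?thesis
      unfolding flip_def comp_apply transpose_def eq by auto
  next
    case False
    then have "q \<noteq> p" "q \<noteq> n + 1 - p"
      using sub(2) mirror_mem[OF sub(2)] by blast+
    then show ?thesis
      using sub False by (simp only: comp_apply flip_not_in insert_subset simp_thms
          transpose_apply_other)
  qed
qed

text \<open>A half contains one member of each pair, so the flip is a product of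
  \<open>card X\<close> disjoint transpositions.\<close>

lemma
  assumes H: "half n H" and X: "X \<subseteq> H"
  shows flip_permutes: "flip n X permutes {1..n}"
    and sign_flip: "sign (flip n X) = (- 1) ^ card X"
proof -
  have "finite X"
    using assms by (auto simp: half_def intro: finite_subset)
  then have "flip n X permutes {1..n} \<and> sign (flip n X) = (- 1) ^ card X"
    using X
  proof (induction X rule: finite_induct)
    case empty
    have eq: "flip n {} = id"
      by (auto simp: flip_def)
    show ?case
      unfolding eq by (simp only: permutes_id sign_id card.empty power_0 simp_thms)
  next
    case (insert p X)
    then have IH: "flip n X permutes {1..n}" "sign (flip n X) = (- 1) ^ card X"
      by auto
    have p: "p \<in> {1..n}"
      using half_subset[OF H] insert.prems by blast
    then have tr: "transpose p (n + 1 - p) permutes {1..n}"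
      by (intro permutes_swap_id) auto
    have eq: "flip n (insert p X) = transpose p (n + 1 - p) \<circ> flip n X"
      using flip_insert[OF H insert.prems insert.hyps(2)] .
    have "permutation (flip n X)"
      using IH(1) by (auto simp: permutation_permutes)
    then have "sign (flip n (insert p X)) = (- 1) ^ card (insert p X)"
      unfolding eq using half_fixpoint_free[OF H p] IH(2) insert.hyps
      by (simp add: sign_compose permutation_swap_id sign_swap_id)
    then show ?case
      using permutes_compose[OF IH(1) tr] unfolding eq by blast
  qed
  then show "flip n X permutes {1..n}" "sign (flip n X) = (- 1) ^ card X"
    by auto
qed

lemma
  assumes "q \<in> {1..n}"
  shows flip_swap: "q \<in> X \<or> n + 1 - q \<in> X \<Longrightarrow>
      flip n X q = n + 1 - q \<and> flip n X (n + 1 - q) = q"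
    and flip_fix: "\<not> (q \<in> X \<or> n + 1 - q \<in> X) \<Longrightarrow>
      flip n X q = q \<and> flip n X (n + 1 - q) = n + 1 - q"
  unfolding flip_def mirror_mirror[OF assms]
  by (simp_all only: if_True if_False disj_commute simp_thms)

lemma flip_flip:
  assumes "X \<subseteq> {1..n}" shows "flip n X (flip n X q) = q"
proof (cases "q \<in> {1..n}")
  case True
  then show ?thesis
    using flip_swap flip_fix by metis
next
  case False
  then show ?thesis
    using flip_not_in[OF assms] by simp
qed

text \<open>For a permutation and q distinct from q' the condition is the same at q and at q', so no
  half has to be fixed. With \<open>n = 2 * k\<close> it encodes \<open>i_p < j_p\<close>.\<close>

definition pair_ordered :: "nat \<Rightarrow> (nat \<Rightarrow> nat) \<Rightarrow> nat \<Rightarrow> bool" where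
  "pair_ordered n \<sigma> q \<longleftrightarrow> (\<sigma> q < \<sigma> (n + 1 - q) \<longleftrightarrow> q < n + 1 - q)"

definition ordered_perms :: "nat \<Rightarrow> (nat \<Rightarrow> nat) set" where
  "ordered_perms n = {\<sigma>. \<sigma> permutes {1..n} \<and> (\<forall>q\<in>{1..n}. pair_ordered n \<sigma> q)}"

text \<open>The two entries of a pair are distinct, so exchanging them reverses their order; pairs
  that miss \<open>X\<close> keep theirs.\<close>

lemma pair_ordered_comp_flip:
  assumes H: "half n H" and X: "X \<subseteq> H" and \<sigma>: "\<sigma> permutes {1..n}" and q: "q \<in> {1..n}"
  shows "pair_ordered n (\<sigma> \<circ> flip n X) q \<longleftrightarrow>
    (pair_ordered n \<sigma> q \<longleftrightarrow> q \<notin> X \<and> n + 1 - q \<notin> X)"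
proof -
  have "\<sigma> q \<noteq> \<sigma> (n + 1 - q)"
    using half_fixpoint_free[OF H q] permutes_inj[OF \<sigma>] by (metis injD)
  with half_fixpoint_free[OF H q]
  have swap: "(\<sigma> (n + 1 - q) < \<sigma> q \<longleftrightarrow> q < n + 1 - q) \<longleftrightarrow> \<not> pair_ordered n \<sigma> q"
    unfolding pair_ordered_def by linarith
  show ?thesis
  proof (cases "q \<in> X \<or> n + 1 - q \<in> X")
    case True
    with flip_swap[OF q] have "pair_ordered n (\<sigma> \<circ> flip n X) q \<longleftrightarrow> \<not> pair_ordered n \<sigma> q"
      unfolding pair_ordered_def[of n "\<sigma> \<circ> flip n X"] by (simp only: comp_apply swap)
    with True show ?thesis
      by blast
  next
    case False
    with flip_fix[OF q] show ?thesis
      unfolding pair_ordered_def by (simp only: comp_apply de_Morgan_disj simp_thms)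
  qed
qed

text \<open>Swapping exactly the misordered pairs makes a permutation ordered, and the set of these
  pairs, each represented by its member in \<open>H\<close>, records how to undo this.\<close>

lemma bij_betw_flip:
  assumes H: "half n H"
  shows "bij_betw (\<lambda>(\<sigma>, X). \<sigma> \<circ> flip n X) (ordered_perms n \<times> Pow H) {\<tau>. \<tau> permutes {1..n}}"
proof -
  \<comment> \<open>\<open>bad \<tau>\<close> is the second component of the inverse map; the first
    is \<open>\<tau> \<circ> flip n (bad \<tau>)\<close>.\<close>
  define bad where "bad = (\<lambda>\<tau>. {q\<in>H. \<not> pair_ordered n \<tau> q})"
  note Hn = half_subset[OF H] and Hr = half_iff[OF H]
  have badH: "bad \<tau> \<subseteq> H" for \<tau>
    by (auto simp: bad_def)
  \<comment> \<open>\<open>bad\<close> inspects only positions in \<open>H\<close>, whereas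
    \<open>ordered_perms\<close> speaks of all positions.\<close>
  have sym: "pair_ordered n \<tau> (n + 1 - q) \<longleftrightarrow> pair_ordered n \<tau> q"
    if "\<tau> permutes {1..n}" "q \<in> {1..n}" for \<tau> q
  proof -
    have "\<tau> q \<noteq> \<tau> (n + 1 - q)"
      using half_fixpoint_free[OF H that(2)] permutes_inj[OF that(1)] by (metis injD)
    with half_fixpoint_free[OF H that(2)] show ?thesis
      unfolding pair_ordered_def mirror_mirror[OF that(2)] by linarith
  qed
  have bad_comp: "bad (\<sigma> \<circ> flip n X) = X" if "\<sigma> \<in> ordered_perms n" "X \<subseteq> H" for \<sigma> X
  proof -
    have "pair_ordered n (\<sigma> \<circ> flip n X) q \<longleftrightarrow> q \<notin> X" if "q \<in> H" for q
    proof -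
      have "q \<in> {1..n}" "n + 1 - q \<notin> X"
        using Hn Hr[of q] \<open>q \<in> H\<close> \<open>X \<subseteq> H\<close> by blast+
      with pair_ordered_comp_flip[OF H \<open>X \<subseteq> H\<close>, of \<sigma> q] \<open>\<sigma> \<in> ordered_perms n\<close> show ?thesis
        by (auto simp: ordered_perms_def)
    qed
    with \<open>X \<subseteq> H\<close> show ?thesis
      by (auto simp: bad_def)
  qed
  have cancel: "\<tau> \<circ> flip n X \<circ> flip n X = \<tau>" if "X \<subseteq> H" for \<tau> :: "nat \<Rightarrow> nat" and X
    using flip_flip[of X n] that Hn by (auto simp: fun_eq_iff)
  have comp_bad: "\<tau> \<circ> flip n (bad \<tau>) \<in> ordered_perms n" if \<tau>: "\<tau> permutes {1..n}" for \<tau>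
  proof -
    have "pair_ordered n (\<tau> \<circ> flip n (bad \<tau>)) q" if q: "q \<in> {1..n}" for q
    proof -
      have "pair_ordered n \<tau> q \<longleftrightarrow> q \<notin> bad \<tau> \<and> n + 1 - q \<notin> bad \<tau>"
        using Hr[OF q] sym[OF \<tau> q] by (auto simp: bad_def simp del: One_nat_def)
      then show ?thesis
        unfolding pair_ordered_comp_flip[OF H badH \<tau> q] by simp
    qed
    then show ?thesis
      using permutes_compose[OF flip_permutes[OF H badH] \<tau>] by (auto simp: ordered_perms_def)
  qed
  show ?thesis
  proof (rule bij_betw_byWitness[where f' = "\<lambda>\<tau>. (\<tau> \<circ> flip n (bad \<tau>), bad \<tau>)"], goal_cases)
    case 1
    then show ?case
      by (auto simp: bad_comp cancel simp del: comp_apply)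
  next
    case 2
    then show ?case
      using cancel[OF badH] by auto
  next
    case 3
    then show ?case
      using flip_permutes[OF H] by (auto simp: ordered_perms_def intro!: permutes_compose)
  next
    case 4
    then show ?case
      using comp_bad badH by auto
  qed
qed

section \<open>Expansion into sums over permutations\<close>

context multiadditive
begin

text \<open>This is \<open>Q R\<close> of the overview.\<close>

definition reflected_sum :: "(nat \<Rightarrow> 'w) \<Rightarrow> nat set \<Rightarrow> 'k" where
  "reflected_sum y R = (\<Sum>\<tau> | \<tau> permutes {1..n}.
     of_int (sign \<tau>) * L (\<lambda>q. y (\<tau> (if q \<in> R then n + 1 - q else q))))"

text \<open>Reindexing by \<open>\<tau> \<circ> transpose p q\<close> reverses the sign. What the
  transposition does to the arguments of \<open>L\<close> depends on \<open>R\<close> and is left to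
  the applications.\<close>

lemma reflected_sum_transpose:
  assumes p: "p \<in> {1..n}" "q \<in> {1..n}" "p \<noteq> q"
  shows "reflected_sum y R = - (\<Sum>\<tau> | \<tau> permutes {1..n}. of_int (sign \<tau>) *
    L (\<lambda>r. y (\<tau> (transpose p q (if r \<in> R then n + 1 - r else r)))))"
proof -
  have t: "transpose p q permutes {1..n}"
    using p by (intro permutes_swap_id) auto
  have sgn: "sign (\<tau> \<circ> transpose p q) = - sign \<tau>" if "\<tau> permutes {1..n}" for \<tau>
  proof -
    have "permutation \<tau>"
      using that by (auto simp: permutation_permutes)
    then show ?thesis
      using p by (simp add: sign_compose permutation_swap_id sign_swap_id)
  qed
  then show ?thesis
    unfolding reflected_sum_def sum_negf[symmetric]
    by (subst sum_permutations_compose_right[OF t], intro sum.cong refl)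
      (simp add: sgn del: One_nat_def)
qed

lemma reflected_sum_eq_0:
  assumes H: "half n H" and R: "R \<subseteq> H" "p \<in> R" "q \<in> R" "p \<noteq> q" and two: "(2::'k) \<noteq> 0"
  shows "reflected_sum y R = 0"
proof -
  have "p \<in> {1..n}" "q \<in> {1..n}"
    using half_subset[OF H] R by blast+
  from reflected_sum_transpose[OF this R(4), of y R]
  have "reflected_sum y R = - reflected_sum y R"
  proof (rule trans)
    \<comment> \<open>A position in \<open>R\<close> reads an entry outside \<open>H\<close>, and a
      position outside \<open>R\<close> reads its own entry, so the entries at \<open>p\<close> and
      \<open>q\<close> are never read.\<close>
    have "transpose p q (if r \<in> R then n + 1 - r else r) = (if r \<in> R then n + 1 - r else r)"
      if "r \<in> {1..n}" for r
      using R half_iff[OF H that] by (intro transpose_apply_other) auto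
    then show "- (\<Sum>\<tau> | \<tau> permutes {1..n}. of_int (sign \<tau>) *
        L (\<lambda>r. y (\<tau> (transpose p q (if r \<in> R then n + 1 - r else r))))) = - reflected_sum y R"
      unfolding reflected_sum_def
      by (intro arg_cong[where f = uminus] sum.cong refl arg_cong2[where f = "(*)"] cong) simp
  qed
  then have "2 * reflected_sum y R = 0"
    by (simp only: mult_2 eq_neg_iff_add_eq_0)
  with two show ?thesis by simp
qed

text \<open>For \<open>R = {p}\<close> the positions p and p' both read the entry at p'; for the
  singleton of p' both read the entry at p. Transposing p and p' exchanges the two cases.\<close>

lemma reflected_sum_singleton:
  assumes p: "p \<in> {1..n}" "n + 1 - p \<noteq> p"
  shows "reflected_sum y {n + 1 - p} = - reflected_sum y {p}"
proof -
  have *: "transpose p (n + 1 - p) (if r \<in> {n + 1 - p} then n + 1 - r else r) =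
      (if r \<in> {p} then n + 1 - r else r)" if "r \<in> {1..n}" for r
    using p that by (auto simp: transpose_def)
  have "n + 1 - p \<in> {1..n}"
    using p by auto
  from reflected_sum_transpose[OF p(1) this p(2)[symmetric], of y "{n + 1 - p}"] show ?thesis
  proof (rule trans)
    show "- (\<Sum>\<tau> | \<tau> permutes {1..n}. of_int (sign \<tau>) * L (\<lambda>r. y (\<tau>
        (transpose p (n + 1 - p) (if r \<in> {n + 1 - p} then n + 1 - r else r))))) =
      - reflected_sum y {p}"
      unfolding reflected_sum_def
      by (intro arg_cong[where f = uminus] sum.cong refl arg_cong2[where f = "(*)"] cong)
        (simp only: *)
  qed
qed

text \<open>Differences stand at \<open>H\<close>, always as own entry minus mirrored entry, and
  sums elsewhere. \<open>H = {1..k}\<close> yields the first sum of the formula, the complement the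
  second.\<close>

definition signed_product_sum :: "(nat \<Rightarrow> 'w) \<Rightarrow> nat set \<Rightarrow> 'k" where
  "signed_product_sum y H = (\<Sum>\<sigma>\<in>ordered_perms n. of_int (sign \<sigma>) *
     L (\<lambda>q. if q \<in> H then y (\<sigma> q) - y (\<sigma> (n + 1 - q)) else y (\<sigma> q) + y (\<sigma> (n + 1 - q))))"

text \<open>The differences are expanded first, which merges \<open>ordered_perms n\<close> and the
  subsets of \<open>H\<close> into all permutations; the sums on the complement of \<open>H\<close>
  are expanded afterwards.\<close>

lemma signed_product_sum_eq:
  assumes H: "half n H" and y: "y \<in> {1..n} \<rightarrow> W"
  shows "signed_product_sum y H = (\<Sum>R\<in>Pow ({1..n} - H). reflected_sum y R)"
proof -
  let ?P = "{\<tau>. \<tau> permutes {1..n}}"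
  \<comment> \<open>The summand once a term of each difference is chosen, with the sums still
    unexpanded.\<close>
  let ?M = "\<lambda>\<tau>. L (\<lambda>q. if q \<in> H then y (\<tau> q) else y (\<tau> q) + y (\<tau> (n + 1 - q)))"
  note Hn = half_subset[OF H] and Hr = half_iff[OF H]
  have mem: "y (\<tau> q) \<in> W" "y (\<tau> (n + 1 - q)) \<in> W"
    if "\<tau> permutes {1..n}" "q \<in> {1..n}" for \<tau> q
  proof -
    have "n + 1 - q \<in> {1..n}"
      using that(2) by auto
    then show "y (\<tau> q) \<in> W" "y (\<tau> (n + 1 - q)) \<in> W"
      using y permutes_in_image[OF that(1)] that(2) by (blast dest: funcset_mem)+
  qed
  have expand: "of_int (sign \<sigma>) * L (\<lambda>q. if q \<in> H then y (\<sigma> q) - y (\<sigma> (n + 1 - q))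
        else y (\<sigma> q) + y (\<sigma> (n + 1 - q))) =
      (\<Sum>X\<in>Pow H. of_int (sign (\<sigma> \<circ> flip n X)) * ?M (\<sigma> \<circ> flip n X))"
    if "\<sigma> \<in> ordered_perms n" for \<sigma>
  proof -
    have \<sigma>: "\<sigma> permutes {1..n}"
      using that by (simp add: ordered_perms_def)
    let ?u = "\<lambda>q. if q \<in> H then y (\<sigma> q) else y (\<sigma> q) + y (\<sigma> (n + 1 - q))"
    let ?v = "\<lambda>q. y (\<sigma> (n + 1 - q))"
    have u: "?u \<in> {1..n} \<rightarrow> W" and v: "?v \<in> {1..n} \<rightarrow> W"
      using mem[OF \<sigma>] add_closed by auto
    then have v': "(\<lambda>q. - ?v q) \<in> {1..n} \<rightarrow> W"
      using uminus_closed by auto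
    have "L (\<lambda>q. if q \<in> H then y (\<sigma> q) - y (\<sigma> (n + 1 - q))
        else y (\<sigma> q) + y (\<sigma> (n + 1 - q))) = L (\<lambda>q. if q \<in> H then ?u q + - ?v q else ?u q)"
      by (rule cong) simp
    also have "\<dots> = (\<Sum>X\<in>Pow H. L (\<lambda>q. if q \<in> X then - ?v q else ?u q))"
      by (rule sum_expansion[OF Hn u v'])
    also have "\<dots> = (\<Sum>X\<in>Pow H. (- 1) ^ card X * ?M (\<sigma> \<circ> flip n X))"
    proof (rule sum.cong[OF refl])
      fix X assume "X \<in> Pow H"
      then have X: "X \<subseteq> H" by simp
      have "L (\<lambda>q. if q \<in> X then - ?v q else ?u q) =
          (- 1) ^ card X * L (\<lambda>q. if q \<in> X then ?v q else ?u q)"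
        using uminus_expansion[OF _ u v] X Hn by blast
      \<comment> \<open>The flip moves the chosen entries into place. It also exchanges the two
        entries of the factor at the mirrored position, but that factor is a sum and does not
        change.\<close>
      also have "L (\<lambda>q. if q \<in> X then ?v q else ?u q) = ?M (\<sigma> \<circ> flip n X)"
      proof (rule cong)
        fix q assume q: "q \<in> {1..n}"
        have "q \<in> X \<Longrightarrow> q \<in> H" "n + 1 - q \<in> X \<Longrightarrow> q \<notin> H" "n + 1 - (n + 1 - q) = q"
          using X Hr[OF q] mirror_mirror[OF q] by blast+
        then show "(if q \<in> X then ?v q else ?u q) =
            (if q \<in> H then y ((\<sigma> \<circ> flip n X) q)
             else y ((\<sigma> \<circ> flip n X) q) + y ((\<sigma> \<circ> flip n X) (n + 1 - q)))"
          by (auto simp: flip_def add.commute)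
      qed
      finally show "L (\<lambda>q. if q \<in> X then - ?v q else ?u q) =
          (- 1) ^ card X * ?M (\<sigma> \<circ> flip n X)" .
    qed
    finally have *: "L (\<lambda>q. if q \<in> H then y (\<sigma> q) - y (\<sigma> (n + 1 - q))
        else y (\<sigma> q) + y (\<sigma> (n + 1 - q))) =
        (\<Sum>X\<in>Pow H. (- 1) ^ card X * ?M (\<sigma> \<circ> flip n X))" .
    \<comment> \<open>The signs collected from the chosen negative terms are exactly the sign of the
      flip.\<close>
    have sgn: "sign (\<sigma> \<circ> flip n X) = sign \<sigma> * (- 1) ^ card X" if "X \<subseteq> H" for X
    proof -
      have "permutation \<sigma>" "permutation (flip n X)"
        using \<sigma> flip_permutes[OF H that] by (auto simp: permutation_permutes)
      then show ?thesis
        by (simp add: sign_compose sign_flip[OF H that])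
    qed
    show ?thesis
      unfolding * sum_distrib_left by (rule sum.cong) (simp_all add: sgn mult.assoc)
  qed
  have "signed_product_sum y H =
      (\<Sum>\<sigma>\<in>ordered_perms n. \<Sum>X\<in>Pow H. of_int (sign (\<sigma> \<circ> flip n X)) * ?M (\<sigma> \<circ> flip n X))"
    unfolding signed_product_sum_def by (rule sum.cong[OF refl expand])
  also have "\<dots> = (\<Sum>(\<sigma>, X)\<in>ordered_perms n \<times> Pow H.
      of_int (sign (\<sigma> \<circ> flip n X)) * ?M (\<sigma> \<circ> flip n X))"
    by (rule sum.cartesian_product)
  also have "\<dots> = (\<Sum>\<tau>\<in>?P. of_int (sign \<tau>) * ?M \<tau>)"
    unfolding sum.reindex_bij_betw[OF bij_betw_flip[OF H], symmetric] case_prod_beta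
    by (rule refl)
  also have "\<dots> = (\<Sum>\<tau>\<in>?P. \<Sum>R\<in>Pow ({1..n} - H).
      of_int (sign \<tau>) * L (\<lambda>q. y (\<tau> (if q \<in> R then n + 1 - q else q))))"
  proof (rule sum.cong[OF refl])
    fix \<tau> assume "\<tau> \<in> ?P"
    then have \<tau>: "\<tau> permutes {1..n}" by simp
    have uv: "(\<lambda>q. y (\<tau> q)) \<in> {1..n} \<rightarrow> W" "(\<lambda>q. y (\<tau> (n + 1 - q))) \<in> {1..n} \<rightarrow> W"
      using mem[OF \<tau>] by auto
    have "?M \<tau> = L (\<lambda>q. if q \<in> {1..n} - H then y (\<tau> q) + y (\<tau> (n + 1 - q)) else y (\<tau> q))"
      by (rule cong) auto
    also have "\<dots> = (\<Sum>R\<in>Pow ({1..n} - H).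
        L (\<lambda>q. if q \<in> R then y (\<tau> (n + 1 - q)) else y (\<tau> q)))"
      by (rule sum_expansion[OF _ uv]) auto
    also have "\<dots> = (\<Sum>R\<in>Pow ({1..n} - H). L (\<lambda>q. y (\<tau> (if q \<in> R then n + 1 - q else q))))"
      by (intro sum.cong refl cong) simp
    finally show "of_int (sign \<tau>) * ?M \<tau> = (\<Sum>R\<in>Pow ({1..n} - H).
        of_int (sign \<tau>) * L (\<lambda>q. y (\<tau> (if q \<in> R then n + 1 - q else q))))"
      by (simp add: sum_distrib_left)
  qed
  also have "\<dots> = (\<Sum>R\<in>Pow ({1..n} - H). reflected_sum y R)"
    unfolding reflected_sum_def by (rule sum.swap)
  finally show ?thesis .
qed

text \<open>Subsets with two distinct elements vanish by \<open>reflected_sum_eq_0\<close>, which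
  leaves the empty set and the singletons.\<close>

lemma sum_reflected_sum:
  assumes H: "half n H" and two: "(2::'k) \<noteq> 0"
  shows "(\<Sum>R\<in>Pow H. reflected_sum y R) = reflected_sum y {} + (\<Sum>p\<in>H. reflected_sum y {p})"
proof -
  have fin: "finite H"
    using H by (auto simp: half_def intro: finite_subset)
  have "(\<Sum>R\<in>Pow H. reflected_sum y R) = (\<Sum>R\<in>insert {} ((\<lambda>p. {p}) ` H). reflected_sum y R)"
  proof (rule sum.mono_neutral_right)
    show "\<forall>R\<in>Pow H - insert {} ((\<lambda>p. {p}) ` H). reflected_sum y R = 0"
    proof
      fix R assume R: "R \<in> Pow H - insert {} ((\<lambda>p. {p}) ` H)"
      then obtain p where p: "p \<in> R" by blast
      with R have "R \<noteq> {p}" by auto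
      with p obtain q where "q \<in> R" "p \<noteq> q" by blast
      with p R show "reflected_sum y R = 0"
        using reflected_sum_eq_0[OF H _ _ _ _ two] by blast
    qed
  qed (use fin in auto)
  also have "\<dots> = reflected_sum y {} + (\<Sum>R\<in>(\<lambda>p. {p}) ` H. reflected_sum y R)"
    using fin by (intro sum.insert) auto
  also have "(\<Sum>R\<in>(\<lambda>p. {p}) ` H. reflected_sum y R) = (\<Sum>p\<in>H. reflected_sum y {p})"
    by (simp add: sum.reindex inj_on_def)
  finally show ?thesis .
qed

text \<open>Each expansion runs over the subsets of the opposite half. Both contain the term for
  \<open>{}\<close>, whence the factor 2, while mirroring matches the singleton terms of the two
  halves with opposite signs.\<close>

lemma signed_product_sum_add:
  assumes H: "half n H" and y: "y \<in> {1..n} \<rightarrow> W" and two: "(2::'k) \<noteq> 0"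
  shows "signed_product_sum y H + signed_product_sum y ({1..n} - H) =
    2 * (\<Sum>\<tau> | \<tau> permutes {1..n}. of_int (sign \<tau>) * L (\<lambda>q. y (\<tau> q)))"
proof -
  note Hn = half_subset[OF H]
  then have compl: "{1..n} - ({1..n} - H) = H"
    by auto
  have refl: "bij_betw (\<lambda>p. n + 1 - p) H ({1..n} - H)"
  proof (rule bij_betw_byWitness[where f' = "\<lambda>p. n + 1 - p"])
    note * = mirror_mem[of _ n] mirror_mirror[of _ n] half_iff[OF H]
    show "\<forall>p\<in>H. n + 1 - (n + 1 - p) = p" "\<forall>p\<in>{1..n} - H. n + 1 - (n + 1 - p) = p"
      using * Hn by blast+
    show "(\<lambda>p. n + 1 - p) ` H \<subseteq> {1..n} - H" "(\<lambda>p. n + 1 - p) ` ({1..n} - H) \<subseteq> H"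
      using * Hn by blast+
  qed
  have "(\<Sum>p\<in>{1..n} - H. reflected_sum y {p}) = (\<Sum>p\<in>H. reflected_sum y {n + 1 - p})"
    by (rule sum.reindex_bij_betw[OF refl, symmetric])
  also have "\<dots> = - (\<Sum>p\<in>H. reflected_sum y {p})"
    unfolding sum_negf[symmetric] using half_fixpoint_free[OF H] Hn
    by (intro sum.cong refl reflected_sum_singleton) auto
  finally show ?thesis
    unfolding signed_product_sum_eq[OF H y] signed_product_sum_eq[OF half_Compl[OF H] y] compl
      sum_reflected_sum[OF H two] sum_reflected_sum[OF half_Compl[OF H] two]
    by (simp add: reflected_sum_def)
qed

end

section \<open>The index set\<close>

text \<open>The tensor position of the \<open>m\<close>-th entry of \<open>(i\<^sub>1, j\<^sub>1, \<dots>, i\<^sub>k, j\<^sub>k)\<close>: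
  \<open>p\<close> for \<open>i\<^sub>p\<close> and \<open>p'\<close> for \<open>j\<^sub>p\<close>.\<close>

definition pair_position :: "nat \<Rightarrow> nat \<Rightarrow> nat" where
  "pair_position k m = (if m \<in> {1..2 * k}
     then if odd m then (m + 1) div 2 else 2 * k + 1 - m div 2 else m)"

lemma
  shows pair_position_permutes: "pair_position k permutes {1..2 * k}"
    and sign_pair_position: "sign (pair_position k) = 1"
proof -
  have "pair_position k permutes {1..2 * k} \<and> sign (pair_position k) = 1"
  proof (induction k)
    case 0
    have eq: "pair_position 0 = id"
      by (auto simp: pair_position_def)
    show ?case
      unfolding eq by (simp only: permutes_id sign_id simp_thms)
  next
    case (Suc k)
    \<comment> \<open>Inserting a new innermost pair shifts the right half by two places. This is the square of a
      cycle, hence even.\<close>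
    define c where "c = (\<lambda>q. if k < q \<and> q \<le> 2 * k + 1 then q + 1
      else if q = 2 * k + 2 then k + 1 else q)"
    let ?n = "2 * Suc k"
    have "inj c"
      by (rule injI) (auto simp: c_def split: if_splits)
    moreover have "c ` {1..?n} \<subseteq> {1..?n}"
      by (auto simp: c_def)
    ultimately have "bij_betw c {1..?n} {1..?n}"
      using endo_inj_surj[of "{1..?n}" c] by (auto simp: bij_betw_def intro: inj_on_subset)
    then have c: "c permutes {1..?n}"
      by (rule bij_imp_permutes) (auto simp: c_def)
    have pos: "pair_position k permutes {1..?n}"
      using conjunct1[OF Suc] by (rule permutes_subset) auto
    \<comment> \<open>Of the old values only those in \<open>{k + 1..2 * k}\<close> move, by two;
      the new entries \<open>2 * k + 1\<close> and \<open>2 * k + 2\<close>, fixed by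
      \<open>pair_position k\<close>, land in the gap at \<open>k + 1\<close> and
      \<open>k + 2\<close>.\<close>
    have eq: "pair_position (Suc k) = c \<circ> c \<circ> pair_position k"
    proof
      fix m
      consider "m = 0" | "m \<in> {1..2 * k}" | "m = 2 * k + 1" | "m = 2 * k + 2" | "m > 2 * k + 2"
        by fastforce
      then show "pair_position (Suc k) m = (c \<circ> c \<circ> pair_position k) m"
      proof cases
        case 2
        then show ?thesis
          by (cases "odd m") (auto simp: pair_position_def c_def elim!: oddE evenE)
      qed (auto simp: pair_position_def c_def)
    qed
    have "permutation c" "permutation (pair_position k)"
      using c pos by (auto simp: permutation_permutes)
    then have "sign (pair_position (Suc k)) = 1"
      unfolding eq using Suc by (simp add: sign_compose permutation_compose)
    moreover have "pair_position (Suc k) permutes {1..?n}"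
      unfolding eq by (intro permutes_compose c pos)
    ultimately show ?case
      by blast
  qed
  then show "pair_position k permutes {1..2 * k}" "sign (pair_position k) = 1"
    by auto
qed

definition perm_tuple :: "nat \<Rightarrow> (nat \<Rightarrow> nat) \<Rightarrow> nat list" where
  "perm_tuple k \<sigma> = map (\<sigma> \<circ> pair_position k) [1..<2 * k + 1]"

lemma length_perm_tuple [simp]: "length (perm_tuple k \<sigma>) = 2 * k"
  by (simp add: perm_tuple_def)

lemma nth_perm_tuple: "m < 2 * k \<Longrightarrow> perm_tuple k \<sigma> ! m = \<sigma> (pair_position k (m + 1))"
  by (simp add: perm_tuple_def del: upt_Suc)

lemma
  assumes "p \<in> {1..k}"
  shows idx_i_perm_tuple: "idx_i (perm_tuple k \<sigma>) p = \<sigma> p"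
    and idx_j_perm_tuple: "idx_j (perm_tuple k \<sigma>) p = \<sigma> (2 * k + 1 - p)"
proof -
  have "pair_position k (2 * p - 2 + 1) = p" "pair_position k (2 * p - 1 + 1) = 2 * k + 1 - p"
    using assms by (auto simp: pair_position_def)
  moreover have "2 * p - 2 < 2 * k" "2 * p - 1 < 2 * k"
    using assms by auto
  ultimately show "idx_i (perm_tuple k \<sigma>) p = \<sigma> p"
    "idx_j (perm_tuple k \<sigma>) p = \<sigma> (2 * k + 1 - p)"
    by (simp_all only: idx_i_def idx_j_def nth_perm_tuple)
qed

text \<open>The permutation behind the tuple is \<open>\<sigma> \<circ> pair_position k\<close>, and
  \<open>pair_position k\<close> is even.\<close>

lemma tuple_sign_perm_tuple:
  assumes \<sigma>: "\<sigma> permutes {1..2 * k}"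
  shows "tuple_sign (perm_tuple k \<sigma>) = sign \<sigma>"
proof -
  have "(\<lambda>p. if p \<in> {1..length (perm_tuple k \<sigma>)} then perm_tuple k \<sigma> ! (p - 1) else p) =
      \<sigma> \<circ> pair_position k" (is "?l = _")
  proof
    fix p
    show "?l p = (\<sigma> \<circ> pair_position k) p"
    proof (cases "p \<in> {1..2 * k}")
      case True
      then have "p - 1 < 2 * k" "p - 1 + 1 = p"
        by auto
      with True show ?thesis
        by (simp add: nth_perm_tuple)
    next
      case False
      then have "pair_position k p = p" "\<sigma> p = p"
        using permutes_not_in[OF pair_position_permutes] permutes_not_in[OF \<sigma>] by blast+
      with False show ?thesis
        by auto
    qed
  qed
  moreover have "permutation \<sigma>" "permutation (pair_position k)"
    using \<sigma> pair_position_permutes by (auto simp: permutation_permutes)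
  ultimately show ?thesis
    unfolding tuple_sign_def by (simp add: sign_compose sign_pair_position)
qed

text \<open>Each mirrored pair has exactly one member in \<open>{1..k}\<close>; at the other member
  both comparisons in \<open>pair_ordered\<close> are reversed.\<close>

lemma ordered_perms_even:
  "\<sigma> \<in> ordered_perms (2 * k) \<longleftrightarrow>
    \<sigma> permutes {1..2 * k} \<and> (\<forall>p\<in>{1..k}. \<sigma> p < \<sigma> (2 * k + 1 - p))"
proof (cases "\<sigma> permutes {1..2 * k}")
  case True
  have "(\<forall>q\<in>{1..2 * k}. pair_ordered (2 * k) \<sigma> q) \<longleftrightarrow> (\<forall>p\<in>{1..k}. \<sigma> p < \<sigma> (2 * k + 1 - p))"
  proof (intro iffI ballI)
    fix p assume "\<forall>q\<in>{1..2 * k}. pair_ordered (2 * k) \<sigma> q" and p: "p \<in> {1..k}"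
    then have "pair_ordered (2 * k) \<sigma> p"
      by auto
    with p show "\<sigma> p < \<sigma> (2 * k + 1 - p)"
      by (auto simp: pair_ordered_def)
  next
    fix q assume *: "\<forall>p\<in>{1..k}. \<sigma> p < \<sigma> (2 * k + 1 - p)" and q: "q \<in> {1..2 * k}"
    show "pair_ordered (2 * k) \<sigma> q"
    proof (cases "q \<le> k")
      case True
      with q bspec[OF *, of q] show ?thesis
        by (auto simp: pair_ordered_def)
    next
      case False
      then have "2 * k + 1 - q \<in> {1..k}" "2 * k + 1 - (2 * k + 1 - q) = q" "\<not> q < 2 * k + 1 - q"
        using q by auto
      with bspec[OF *, of "2 * k + 1 - q"] show ?thesis
        by (auto simp: pair_ordered_def)
    qed
  qed
  with True show ?thesis
    by (simp add: ordered_perms_def)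
qed (simp add: ordered_perms_def)

text \<open>A tuple lists the entries of a permutation in the order given by
  \<open>pair_position k\<close>, which can be undone; the inequalities correspond by
  \<open>ordered_perms_even\<close>.\<close>

lemma bij_betw_perm_tuple: "bij_betw (perm_tuple k) (ordered_perms (2 * k)) (index_set k)"
  unfolding bij_betw_def
proof (intro conjI subset_antisym subsetI)
  let ?\<rho> = "pair_position k"
  note \<rho> = pair_position_permutes[of k]
  show "inj_on (perm_tuple k) (ordered_perms (2 * k))"
  proof (rule inj_onI)
    fix \<sigma> \<tau> assume mem: "\<sigma> \<in> ordered_perms (2 * k)" "\<tau> \<in> ordered_perms (2 * k)"
      and eq: "perm_tuple k \<sigma> = perm_tuple k \<tau>"
    then have perms: "\<sigma> permutes {1..2 * k}" "\<tau> permutes {1..2 * k}"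
      by (auto simp: ordered_perms_def)
    show "\<sigma> = \<tau>"
    proof
      fix q
      show "\<sigma> q = \<tau> q"
      proof (cases "q \<in> {1..2 * k}")
        case True
        then obtain m where m: "m \<in> {1..2 * k}" "q = ?\<rho> m"
          using permutes_image[OF \<rho>] by blast
        from m(1) have "m - 1 < 2 * k" "m - 1 + 1 = m"
          by auto
        with m(2) nth_perm_tuple[of "m - 1" k] show ?thesis
          using eq by metis
      next
        case False
        then show ?thesis
          using perms[THEN permutes_not_in] by simp
      qed
    qed
  qed
  fix a
  show "a \<in> index_set k" if "a \<in> perm_tuple k ` ordered_perms (2 * k)"
  proof -
    from that obtain \<sigma> where \<sigma>: "\<sigma> permutes {1..2 * k}"
      "\<forall>p\<in>{1..k}. \<sigma> p < \<sigma> (2 * k + 1 - p)" and a: "a = perm_tuple k \<sigma>"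
      by (auto simp: ordered_perms_even simp del: One_nat_def)
    have perm: "\<sigma> \<circ> ?\<rho> permutes {1..2 * k}"
      by (rule permutes_compose[OF \<rho> \<sigma>(1)])
    have upt: "set [1..<2 * k + 1] = {1..2 * k}"
      by auto
    have "set a \<subseteq> {1..2 * k}"
      unfolding a perm_tuple_def set_map upt permutes_image[OF perm] by simp
    moreover have "distinct a"
      unfolding a perm_tuple_def using permutes_inj_on[OF perm] by (simp add: distinct_map)
    ultimately show ?thesis
      using \<sigma>(2) by (simp add: index_set_def a idx_i_perm_tuple idx_j_perm_tuple)
  qed
  show "a \<in> perm_tuple k ` ordered_perms (2 * k)" if "a \<in> index_set k"
  proof -
    from that have a: "length a = 2 * k" "set a \<subseteq> {1..2 * k}" "distinct a"
      "\<forall>p\<in>{1..k}. idx_i a p < idx_j a p"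
      by (auto simp: index_set_def)
    \<comment> \<open>The permutation from \<open>tuple_sign\<close>, extended by the identity
      outside the index range.\<close>
    define \<pi> where "\<pi> = (\<lambda>p. if p \<in> {1..2 * k} then a ! (p - 1) else p)"
    have "inj_on \<pi> {1..2 * k}"
    proof (rule inj_onI)
      fix p q assume "p \<in> {1..2 * k}" "q \<in> {1..2 * k}" "\<pi> p = \<pi> q"
      then have "p - 1 = q - 1"
        using nth_eq_iff_index_eq[OF a(3), of "p - 1" "q - 1"] a(1) by (auto simp: \<pi>_def)
      with \<open>p \<in> {1..2 * k}\<close> \<open>q \<in> {1..2 * k}\<close> show "p = q"
        by auto
    qed
    moreover have "\<pi> ` {1..2 * k} \<subseteq> {1..2 * k}"
    proof safe
      fix p assume "p \<in> {1..2 * k}"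
      moreover from this have "a ! (p - 1) \<in> set a"
        using a(1) by (intro nth_mem) auto
      ultimately show "\<pi> p \<in> {1..2 * k}"
        using a(2) by (auto simp: \<pi>_def)
    qed
    ultimately have "bij_betw \<pi> {1..2 * k} {1..2 * k}"
      using endo_inj_surj[of "{1..2 * k}" \<pi>] by (simp add: bij_betw_def)
    then have \<pi>: "\<pi> permutes {1..2 * k}"
      by (rule bij_imp_permutes) (auto simp: \<pi>_def)
    \<comment> \<open>Undoing \<open>pair_position k\<close> puts \<open>i_p\<close> at position p
      and \<open>j_p\<close> at position p'.\<close>
    define \<sigma> where "\<sigma> = \<pi> \<circ> inv_into UNIV ?\<rho>"
    have \<sigma>: "\<sigma> permutes {1..2 * k}"
      unfolding \<sigma>_def by (intro permutes_compose permutes_inv \<rho> \<pi>)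
    have eq: "perm_tuple k \<sigma> = a"
    proof (rule nth_equalityI)
      fix m assume "m < length (perm_tuple k \<sigma>)"
      then have m: "m < 2 * k" "m + 1 \<in> {1..2 * k}"
        by auto
      then have "perm_tuple k \<sigma> ! m = \<pi> (m + 1)"
        by (simp add: nth_perm_tuple \<sigma>_def permutes_inverses(2)[OF \<rho>] del: One_nat_def)
      with m(2) show "perm_tuple k \<sigma> ! m = a ! m"
        by (simp add: \<pi>_def)
    qed (simp add: a(1))
    have "\<sigma> p < \<sigma> (2 * k + 1 - p)" if "p \<in> {1..k}" for p
      using bspec[OF a(4) that] unfolding eq[symmetric]
      by (simp only: idx_i_perm_tuple[OF that] idx_j_perm_tuple[OF that])
    then have "\<sigma> \<in> ordered_perms (2 * k)"
      using \<sigma> by (simp only: ordered_perms_even) blast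
    with eq show ?thesis
      by blast
  qed
qed

section \<open>The two sums of the formula as signed product sums\<close>

lemma half_atLeastAtMost: "half (2 * k) {1..k}"
  by (auto simp: half_def)

text \<open>\<open>\<Phi> f g\<close> puts \<open>f p\<close> at position p and \<open>g p\<close>
  at p', hence the reverse order. In the second sum the factor at p' is \<open>i\<close>-term minus
  \<open>j\<close>-term, the negative of the difference in \<open>signed_product_sum\<close>; these
  \<open>k\<close> reversals account for \<open>(- 1) ^ k\<close>.\<close>

lemma (in multiadditive)
  assumes n: "n = 2 * k" and y: "y \<in> {1..n} \<rightarrow> W"
  defines "\<Phi> \<equiv> \<lambda>f g. L (\<lambda>q. if q \<in> {1..k} then f q else g (n + 1 - q))"
  shows sum_index_set_diff_add:
    "(\<Sum>a\<in>index_set k. of_int (tuple_sign a) *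
        \<Phi> (\<lambda>p. y (idx_i a p) - y (idx_j a p)) (\<lambda>p. y (idx_i a p) + y (idx_j a p))) =
      signed_product_sum y {1..k}"
    and sum_index_set_add_diff:
    "(\<Sum>a\<in>index_set k. (- 1) ^ k * of_int (tuple_sign a) *
        \<Phi> (\<lambda>p. y (idx_i a p) + y (idx_j a p)) (\<lambda>p. y (idx_i a p) - y (idx_j a p))) =
      signed_product_sum y ({1..n} - {1..k})"
proof -
  have r: "n + 1 - q \<in> {1..k}" "2 * k + 1 - (n + 1 - q) = q" if "q \<in> {1..n}" "q \<notin> {1..k}" for q
    using that n by auto
  have bij: "(\<Sum>a\<in>index_set k. f a) = (\<Sum>\<sigma>\<in>ordered_perms n. f (perm_tuple k \<sigma>))"
    for f :: "nat list \<Rightarrow> 'k"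
    unfolding n by (rule sum.reindex_bij_betw[OF bij_betw_perm_tuple, symmetric])
  have sgn: "tuple_sign (perm_tuple k \<sigma>) = sign \<sigma>" if "\<sigma> \<in> ordered_perms n" for \<sigma>
    using that n by (intro tuple_sign_perm_tuple) (simp add: ordered_perms_def)
  show "(\<Sum>a\<in>index_set k. of_int (tuple_sign a) *
        \<Phi> (\<lambda>p. y (idx_i a p) - y (idx_j a p)) (\<lambda>p. y (idx_i a p) + y (idx_j a p))) =
      signed_product_sum y {1..k}"
    unfolding bij signed_product_sum_def \<Phi>_def
  proof (intro sum.cong refl arg_cong2[where f = "(*)"] cong)
    fix \<sigma> q assume q: "q \<in> {1..n}"
    show "(if q \<in> {1..k} then y (idx_i (perm_tuple k \<sigma>) q) - y (idx_j (perm_tuple k \<sigma>) q)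
        else y (idx_i (perm_tuple k \<sigma>) (n + 1 - q)) + y (idx_j (perm_tuple k \<sigma>) (n + 1 - q))) =
      (if q \<in> {1..k} then y (\<sigma> q) - y (\<sigma> (n + 1 - q)) else y (\<sigma> q) + y (\<sigma> (n + 1 - q)))"
    proof (cases "q \<in> {1..k}")
      case True
      then show ?thesis
        by (simp only: if_True idx_i_perm_tuple idx_j_perm_tuple n)
    next
      case False
      then show ?thesis
        using r[OF q False] by (simp only: if_False idx_i_perm_tuple idx_j_perm_tuple add.commute)
    qed
  qed (simp add: sgn)
  let ?H = "{1..n} - {1..k}"
  have card: "card ?H = k"
    using n by (subst card_Diff_subset) auto
  have "(- 1) ^ k * of_int (tuple_sign (perm_tuple k \<sigma>)) *
        \<Phi> (\<lambda>p. y (idx_i (perm_tuple k \<sigma>) p) + y (idx_j (perm_tuple k \<sigma>) p))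
          (\<lambda>p. y (idx_i (perm_tuple k \<sigma>) p) - y (idx_j (perm_tuple k \<sigma>) p)) =
      of_int (sign \<sigma>) *
        L (\<lambda>q. if q \<in> ?H then y (\<sigma> q) - y (\<sigma> (n + 1 - q)) else y (\<sigma> q) + y (\<sigma> (n + 1 - q)))"
    if \<sigma>: "\<sigma> \<in> ordered_perms n" for \<sigma>
  proof -
    let ?u = "\<lambda>q. y (\<sigma> q) + y (\<sigma> (n + 1 - q))" and ?v = "\<lambda>q. y (\<sigma> q) - y (\<sigma> (n + 1 - q))"
    have mem: "y (\<sigma> q) \<in> W" "y (\<sigma> (n + 1 - q)) \<in> W" if "q \<in> {1..n}" for q
    proof -
      have "\<sigma> permutes {1..n}" "n + 1 - q \<in> {1..n}"
        using \<sigma> that by (auto simp: ordered_perms_def)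
      then show "y (\<sigma> q) \<in> W" "y (\<sigma> (n + 1 - q)) \<in> W"
        using y that permutes_in_image[of \<sigma> "{1..n}"] by (blast dest: funcset_mem)+
    qed
    have uv: "?u \<in> {1..n} \<rightarrow> W" "?v \<in> {1..n} \<rightarrow> W"
      using mem add_closed add_closed[OF _ uminus_closed]
      by (auto simp only: Pi_iff diff_conv_add_uminus)
    have "\<Phi> (\<lambda>p. y (idx_i (perm_tuple k \<sigma>) p) + y (idx_j (perm_tuple k \<sigma>) p))
          (\<lambda>p. y (idx_i (perm_tuple k \<sigma>) p) - y (idx_j (perm_tuple k \<sigma>) p)) =
        L (\<lambda>q. if q \<in> ?H then - ?v q else ?u q)"
      unfolding \<Phi>_def
    proof (rule cong)
      fix q assume q: "q \<in> {1..n}"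
      show "(if q \<in> {1..k} then y (idx_i (perm_tuple k \<sigma>) q) + y (idx_j (perm_tuple k \<sigma>) q)
          else y (idx_i (perm_tuple k \<sigma>) (n + 1 - q)) - y (idx_j (perm_tuple k \<sigma>) (n + 1 - q))) =
        (if q \<in> ?H then - ?v q else ?u q)"
      proof (cases "q \<in> {1..k}")
        case True
        then show ?thesis
          by (simp only: Diff_iff simp_thms if_True if_False idx_i_perm_tuple idx_j_perm_tuple n)
      next
        case False
        then show ?thesis
          using r[OF q False] q
          by (simp only: Diff_iff simp_thms if_True if_False idx_i_perm_tuple idx_j_perm_tuple
              minus_diff_eq)
      qed
    qed
    also have "\<dots> = (- 1) ^ k * L (\<lambda>q. if q \<in> ?H then ?v q else ?u q)"
      using uminus_expansion[OF _ uv, of ?H] unfolding card by blast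
    \<comment> \<open>The sign of the \<open>k\<close> reversals and the prefactor
      \<open>(- 1) ^ k\<close> multiply to 1.\<close>
    finally show ?thesis
      unfolding sgn[OF \<sigma>] by (simp add: power_mult_distrib[symmetric] mult.left_commute)
  qed
  then show "(\<Sum>a\<in>index_set k. (- 1) ^ k * of_int (tuple_sign a) *
        \<Phi> (\<lambda>p. y (idx_i a p) + y (idx_j a p)) (\<lambda>p. y (idx_i a p) - y (idx_j a p))) =
      signed_product_sum y ?H"
    unfolding bij signed_product_sum_def by (intro sum.cong refl)
qed

section \<open>Tensor powers\<close>

text \<open>Adding \<open>x\<close> to a maximal independent subset of \<open>S\<close> keeps it
  independent, so the values 1 at \<open>x\<close> and 0 on that subset extend to a linear
  functional.\<close>

lemma (in vector_space) exists_separating_functional: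
  assumes "x \<notin> span S"
  shows "\<exists>\<phi>. Vector_Spaces.linear scale (*) \<phi> \<and> (\<forall>y\<in>S. \<phi> y = 0) \<and> \<phi> x \<noteq> 0"
proof -
  interpret K: vector_space "(*) :: 'a \<Rightarrow> 'a \<Rightarrow> 'a"
    by unfold_locales (auto simp: algebra_simps)
  interpret pair: vector_space_pair scale "(*) :: 'a \<Rightarrow> 'a \<Rightarrow> 'a" ..
  obtain B where B: "B \<subseteq> S" "independent B" "S \<subseteq> span B"
    using maximal_independent_subset by blast
  have x: "x \<notin> span B"
    using assms span_mono[OF B(1)] by blast
  from pair.linear_independent_extend[OF independent_insertI[OF x B(2)],
      of "\<lambda>y. if y = x then 1 else 0"]
  obtain \<phi> where \<phi>: "Vector_Spaces.linear scale (*) \<phi>" "\<phi> x = 1"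
    and "\<forall>y\<in>insert x B. \<phi> y = (if y = x then 1 else 0)"
    by auto
  then have "\<phi> y = 0" if "y \<in> B" for y
    using x span_base that by auto
  then have "\<phi> y = 0" if "y \<in> S" for y
    using pair.linear_eq_0_on_span[OF \<phi>(1), of B y] B(3) that by blast
  with \<phi> show ?thesis
    by (intro exI[of _ \<phi>]) simp
qed

text \<open>If the classes differed, a functional separating \<open>f - g\<close> from the span of
  the relations would tell \<open>f\<close> and \<open>g\<close> apart.\<close>

lemma tensor_class_eqI:
  assumes "\<And>\<phi>. Vector_Spaces.linear fun_scale (*) \<phi> \<Longrightarrow> \<forall>r\<in>tensor_relations n W. \<phi> r = 0 \<Longrightarrow>
    \<phi> f = \<phi> g"
  shows "tensor_class n W f = tensor_class n W g"
proof (rule ccontr)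
  assume "tensor_class n W f \<noteq> tensor_class n W g"
  then have "f - g \<notin> fun_vs.span (tensor_relations n W)"
    by (simp add: tensor_class_eq_iff)
  from fun_vs.exists_separating_functional[OF this] obtain \<phi>
    where \<phi>: "Vector_Spaces.linear fun_scale (*) \<phi>" "\<forall>r\<in>tensor_relations n W. \<phi> r = 0"
      "\<phi> (f - g) \<noteq> 0"
    by blast
  interpret \<phi>: Vector_Spaces.linear fun_scale "(*)" \<phi>
    by (rule \<phi>)
  show False
    using assms[OF \<phi>(1,2)] \<phi>(3) by (simp add: \<phi>.diff)
qed

text \<open>Additivity at a position is what vanishing on the additive relations says.\<close>

lemma multiadditive_functional:
  assumes W: "fun_vs.subspace W" and \<phi>: "Vector_Spaces.linear fun_scale (*) \<phi>"
    and rel: "\<forall>r\<in>tensor_relations n W. \<phi> r = 0"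
  shows "multiadditive n W (\<lambda>g. \<phi> (delta (map g [1..<n + 1])))"
proof
  interpret \<phi>: Vector_Spaces.linear fun_scale "(*)" \<phi>
    by (rule \<phi>)
  show "u + v \<in> W" if "u \<in> W" "v \<in> W" for u v
    using W that by (rule fun_vs.subspace_add)
  show "- u \<in> W" if "u \<in> W" for u
    using W that by (rule fun_vs.subspace_neg)
  show "\<phi> (delta (map g [1..<n + 1])) = \<phi> (delta (map h [1..<n + 1]))"
    if "\<And>q. q \<in> {1..n} \<Longrightarrow> g q = h q" for g h
    by (intro arg_cong[where f = \<phi>] arg_cong[where f = delta] map_cong refl that) auto
  fix g p u v
  assume g: "g \<in> {1..n} \<rightarrow> W" and p: "p \<in> {1..n}" and uv: "u \<in> W" "v \<in> W"
  let ?ws = "map g [1..<n + 1]"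
  \<comment> \<open>Tensor position \<open>p\<close> is list position \<open>p - 1\<close>.\<close>
  have upd: "?ws[p - 1 := w] = map (g(p := w)) [1..<n + 1]" for w
    using p by (intro nth_equalityI) (auto simp: nth_list_update simp del: upt_Suc)
  have "?ws \<in> tuples n W"
    using g by (auto simp: tuples_def simp del: upt_Suc)
  moreover have "p - 1 < n"
    using p by auto
  ultimately have "delta (?ws[p - 1 := u + v]) - delta (?ws[p - 1 := u]) - delta (?ws[p - 1 := v])
      \<in> tensor_relations n W"
    unfolding tensor_relations_def using uv by blast
  with rel have "\<phi> (delta (?ws[p - 1 := u + v]) - delta (?ws[p - 1 := u]) -
      delta (?ws[p - 1 := v])) = 0"
    by blast
  then show "\<phi> (delta (map (g(p := u + v)) [1..<n + 1])) =
      \<phi> (delta (map (g(p := u)) [1..<n + 1])) + \<phi> (delta (map (g(p := v)) [1..<n + 1]))"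
    unfolding upd \<phi>.diff by (simp only: diff_diff_eq right_minus_eq)
qed

section \<open>Finite sums in the tensor power\<close>

lemma finsum_tensor_class:
  assumes "finite A" "\<And>a. a \<in> A \<Longrightarrow> f a \<in> free_space (tuples n W)"
  shows "(\<Oplus>\<^bsub>tensor_power n W\<^esub>a\<in>A. tensor_class n W (f a)) = tensor_class n W (\<Sum>a\<in>A. f a)"
  using assms
proof (induction A rule: finite_induct)
  case empty
  interpret abelian_group "tensor_power n W"
    by (rule abelian_group_tensor_power)
  have zero: "\<zero>\<^bsub>tensor_power n W\<^esub> = tensor_class n W 0"
    by (simp add: tensor_power_def)
  show ?case
    by (simp only: finsum_empty sum.empty zero)
next
  case (insert a A)
  interpret abelian_group "tensor_power n W"
    by (rule abelian_group_tensor_power)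
  have "tensor_class n W (f b) \<in> carrier (tensor_power n W)" if "b \<in> insert a A" for b
    using insert.prems[OF that] by (simp add: tensor_power_def)
  then show ?case
    using insert by (simp add: finsum_insert Pi_iff tensor_power_add func_plus)
qed

lemma finsum_smult_pure_tensor:
  assumes "finite A" "\<And>a. a \<in> A \<Longrightarrow> ws a \<in> tuples n W"
  shows "(\<Oplus>\<^bsub>tensor_power n W\<^esub>a\<in>A. c a \<odot>\<^bsub>tensor_power n W\<^esub> pure_tensor n W (ws a)) =
    tensor_class n W (\<Sum>a\<in>A. fun_scale (c a) (delta (ws a)))"
proof -
  have "delta (ws a) \<in> free_space (tuples n W)" if "a \<in> A" for a
    using assms(2)[OF that] by (auto simp: free_space_def delta_def)
  then show ?thesis
    unfolding pure_tensor_def tensor_power_smult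
    by (intro finsum_tensor_class assms(1) fun_vs.subspace_scale[OF subspace_free_space])
qed

text \<open>Reversal puts \<open>g p\<close> at the mirror of \<open>p\<close>; this brings both
  products into the form of \<open>\<Phi>\<close> in \<open>sum_index_set_diff_add\<close>.\<close>

lemma map_append_map_rev:
  "map f [1..<k + 1] @ map g (rev [1..<k + 1]) =
    map (\<lambda>q. if q \<in> {1..k} then f q else g (2 * k + 1 - q)) [1..<2 * k + 1]"
  by (rule nth_equalityI)
    (auto simp: nth_append rev_nth simp del: upt_Suc intro!: arg_cong[where f = g])

section \<open>The determinant formula in the tensor power\<close>

theorem theorem1p1:
  fixes s :: "'k::field \<Rightarrow> 'v::ab_group_add \<Rightarrow> 'v"
    and e :: "nat \<Rightarrow> 'v \<Rightarrow> 'k"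
    and k n :: nat
  assumes char: "CHAR('k) \<noteq> 2"
    and k: "k > 0"
    and n: "n = 2 * k"
    and V: "vector_space s"
    and dim: "vector_space.dim s UNIV = n"
    and basis: "is_basis n (dual_space s) e"
  shows "let W = dual_space s; T = tensor_power n W in
    det_tensor n W e =
      ((1 / 2) \<odot>\<^bsub>T\<^esub>
        (\<Oplus>\<^bsub>T\<^esub>a\<in>index_set k.
          of_int (tuple_sign a) \<odot>\<^bsub>T\<^esub>
            pure_tensor n W
              (map (\<lambda>p. e (idx_i a p) - e (idx_j a p)) [1..<k+1] @
               map (\<lambda>p. e (idx_i a p) + e (idx_j a p)) (rev [1..<k+1]))))
      \<oplus>\<^bsub>T\<^esub>
      ((1 / 2) \<odot>\<^bsub>T\<^esub>
        (\<Oplus>\<^bsub>T\<^esub>a\<in>index_set k.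
          ((- 1) ^ k * of_int (tuple_sign a)) \<odot>\<^bsub>T\<^esub>
            pure_tensor n W
              (map (\<lambda>p. e (idx_i a p) + e (idx_j a p)) [1..<k+1] @
               map (\<lambda>p. e (idx_i a p) - e (idx_j a p)) (rev [1..<k+1]))))"
proof -
  define W where "W = dual_space s"
  define diff_add where "diff_add = (\<lambda>a. map (\<lambda>p. e (idx_i a p) - e (idx_j a p)) [1..<k+1] @
    map (\<lambda>p. e (idx_i a p) + e (idx_j a p)) (rev [1..<k+1]))"
  define add_diff where "add_diff = (\<lambda>a. map (\<lambda>p. e (idx_i a p) + e (idx_j a p)) [1..<k+1] @
    map (\<lambda>p. e (idx_i a p) - e (idx_j a p)) (rev [1..<k+1]))"
  have "W = fun_vs.span (e ` {1..n})"
    using basis by (simp add: is_basis_def W_def)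
  then have W: "fun_vs.subspace W" and eW: "e \<in> {1..n} \<rightarrow> W"
    by (auto intro: fun_vs.subspace_span fun_vs.span_base)
  \<comment> \<open>A characteristic dividing the prime 2 would be 1 or 2.\<close>
  have "CHAR('k) \<noteq> 1"
    by simp
  with char have "\<not> CHAR('k) dvd 2"
    using two_is_prime_nat unfolding prime_nat_iff by blast
  then have two: "(2 :: 'k) \<noteq> 0"
    using of_nat_eq_0_iff_char_dvd[of 2, where ?'a = 'k] by simp
  have fin: "finite (index_set k)"
    using finite_lists_length_eq[of "{1..2 * k}" "2 * k"]
    by (rule rev_finite_subset) (auto simp: index_set_def)
  have idx: "e (idx_i a p) \<in> W" "e (idx_j a p) \<in> W" if "a \<in> index_set k" "p \<in> {1..k}" for a p
  proof -
    have "idx_i a p \<in> set a" "idx_j a p \<in> set a"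
      using that by (auto simp: index_set_def idx_i_def idx_j_def intro!: nth_mem)
    then show "e (idx_i a p) \<in> W" "e (idx_j a p) \<in> W"
      using that(1) eW n by (auto simp: index_set_def dest: funcset_mem)
  qed
  \<comment> \<open>This keeps every summand in the carrier, as finite sums in the abelian group
    require.\<close>
  have tuples: "diff_add a \<in> tuples n W" "add_diff a \<in> tuples n W" if "a \<in> index_set k" for a
    using idx[OF that] n fun_vs.subspace_add[OF W] fun_vs.subspace_diff[OF W]
    by (auto simp: diff_add_def add_diff_def tuples_def simp del: upt_Suc)
  have det_tuples: "map (\<lambda>p. e (\<sigma> p)) [1..<n + 1] \<in> tuples n W" if "\<sigma> permutes {1..n}" for \<sigma>
    using eW permutes_in_image[OF that] by (auto simp: tuples_def Pi_iff simp del: upt_Suc)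
  \<comment> \<open>Representatives of the three sums in the free vector space; their classes are
    compared first and then rewritten as sums in the quotient.\<close>
  let ?det = "\<Sum>\<sigma> | \<sigma> permutes {1..n}.
    fun_scale (of_int (sign \<sigma>)) (delta (map (\<lambda>p. e (\<sigma> p)) [1..<n + 1]))"
  let ?A = "\<Sum>a\<in>index_set k. fun_scale (of_int (tuple_sign a)) (delta (diff_add a))"
  let ?B = "\<Sum>a\<in>index_set k. fun_scale ((- 1) ^ k * of_int (tuple_sign a)) (delta (add_diff a))"
  have "tensor_class n W ?det =
      tensor_class n W (fun_scale (1 / 2) ?A + fun_scale (1 / 2) ?B)"
  proof (rule tensor_class_eqI)
    fix \<phi> :: "(('v \<Rightarrow> 'k) list \<Rightarrow> 'k) \<Rightarrow> 'k"
    assume \<phi>: "Vector_Spaces.linear fun_scale (*) \<phi>" and rel: "\<forall>r\<in>tensor_relations n W. \<phi> r = 0"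
    interpret \<phi>: Vector_Spaces.linear fun_scale "(*)" \<phi>
      by (rule \<phi>)
    interpret L: multiadditive n W "\<lambda>g. \<phi> (delta (map g [1..<n + 1]))"
      by (rule multiadditive_functional[OF W \<phi> rel])
    have A: "\<phi> ?A = L.signed_product_sum e {1..k}"
      unfolding L.sum_index_set_diff_add[OF n eW, symmetric] \<phi>.sum \<phi>.scale diff_add_def
        map_append_map_rev[where k = k, folded n] ..
    have B: "\<phi> ?B = L.signed_product_sum e ({1..n} - {1..k})"
      unfolding L.sum_index_set_add_diff[OF n eW, symmetric] \<phi>.sum \<phi>.scale add_diff_def
        map_append_map_rev[where k = k, folded n] ..
    \<comment> \<open>The left and right halves of the positions are complementary, so their signed
      product sums add up to twice the determinant.\<close>
    have "\<phi> ?A + \<phi> ?B = 2 * \<phi> ?det"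
      unfolding A B using L.signed_product_sum_add[OF half_atLeastAtMost[of k, folded n] eW two]
      by (simp only: \<phi>.sum \<phi>.scale)
    with two show "\<phi> ?det = \<phi> (fun_scale (1 / 2) ?A + fun_scale (1 / 2) ?B)"
      by (simp add: \<phi>.add \<phi>.scale field_simps)
  qed
  also have "\<dots> = (1 / 2) \<odot>\<^bsub>tensor_power n W\<^esub> tensor_class n W ?A
      \<oplus>\<^bsub>tensor_power n W\<^esub> (1 / 2) \<odot>\<^bsub>tensor_power n W\<^esub> tensor_class n W ?B"
    by (simp only: tensor_power_smult tensor_power_add)
  also have "tensor_class n W ?det = det_tensor n W e"
    unfolding det_tensor_def using det_tuples
    by (intro finsum_smult_pure_tensor[symmetric]) (auto intro: finite_permutations)
  also have "tensor_class n W ?A = (\<Oplus>\<^bsub>tensor_power n W\<^esub>a\<in>index_set k.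
      of_int (tuple_sign a) \<odot>\<^bsub>tensor_power n W\<^esub> pure_tensor n W (diff_add a))"
    by (intro finsum_smult_pure_tensor[symmetric] fin tuples)
  also have "tensor_class n W ?B = (\<Oplus>\<^bsub>tensor_power n W\<^esub>a\<in>index_set k.
      ((- 1) ^ k * of_int (tuple_sign a)) \<odot>\<^bsub>tensor_power n W\<^esub> pure_tensor n W (add_diff a))"
    by (intro finsum_smult_pure_tensor[symmetric] fin tuples)
  finally show ?thesis
    unfolding Let_def W_def diff_add_def add_diff_def .
qed

end
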